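(* Let $C=(I,V,E,O)$ be a CDAG and $S\ge 1$. For any complete calculation of the recompute-restricted red-blue pebble game on $C$ using at most $S$ red pebbles and containing exactly $q$ I/O moves (moves of type R1 or R2), there exists a $2S^{NR}$-partitioning of $C$ into $h$ subsets such that $S\cdot h\ge q\ge S\cdot(h-1)$.
   Context: A CDAG is a 4-tuple $C=(I,V,E,O)$ of finite sets with $E\subseteq V\times V$, $(V,E)$ a directed acyclic graph, $I\subseteq V$ (inputs) consisting of vertices with no incoming edges, and $O\subseteq V$ (outputs); vertices without predecessors need not be inputs and vertices without successors need not be outputs. Recompute-restricted red-blue pebble game: with $S$ red pebbles and arbitrarily many blue pebbles, start with a blue pebble on each vertex of $I$. Moves: R1 place a red pebble on a vertex carrying a blue pebble; R2 place a blue pebble on a vertex carrying a red pebble; R3-NR if all immediate predecessors of $v\in V\setminus I$ carry red pebbles (vacuous if none) and a red pebble has never previously been placed on $v$, place a red pebble on $v$; R4 remove a red pebble from any vertex. At most $S$ red pebbles may be on the graph at any time. A complete calculation is a sequence of moves in which each vertex of $V\setminus I$ is fired exactly once by R3-NR and which ends with blue pebbles on all vertices of $O$. For $T\ge 1$, a $T^{NR}$-partitioning of $C$ is a collection of $h$ subsets $V_1,\dots,V_h$ of $V\setminus I$ such that: (P1) they are pairwise disjoint and their union is $V\setminus I$; (P2) there is no cyclic dependence between the subsets (the graph on $\{V_1,\dots,V_h\}$ with an arc $V_i\to V_j$, $i\ne j$, whenever $E$ contains an edge from $V_i$ to $V_j$, is acyclic); (P3) for all $i$, $|\mathrm{In}(V_i)|\le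 T$; (P4) for all $i$, $|\mathrm{Out}(V_i)|\le T$. Here $\mathrm{In}(V_i)$ is the set of vertices of $V\setminus V_i$ having at least one successor in $V_i$, and $\mathrm{Out}(V_i)$ is the set of vertices of $V_i$ that belong to $O$ or have at least one successor outside $V_i$. A $2S^{NR}$-partitioning is a $T^{NR}$-partitioning with $T=2S$. *)

theory Defs
  imports Main
begin

record 'v cdag =
  inputs :: "'v set"
  verts :: "'v set"
  edges :: "('v \<times> 'v) set"
  outputs :: "'v set"

definition is_cdag :: "'v cdag \<Rightarrow> bool" where
  "is_cdag C \<longleftrightarrow>
     finite (verts C) \<and> edges C \<subseteq> verts C \<times> verts C \<and> acyclic (edges C) \<and>
     inputs C \<subseteq> verts C \<and> (\<forall>v\<in>inputs C. \<forall>u. (u, v) \<notin> edges C) \<and>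
     outputs C \<subseteq> verts C"

text \<open>
  The field \<open>was_red\<close> records the history of the game: the vertices on which a red pebble
  has been placed at some earlier point.
\<close>

record 'v pebbling =
  red :: "'v set"
  blue :: "'v set"
  was_red :: "'v set"

definition start :: "'v cdag \<Rightarrow> 'v pebbling" where
  "start C = \<lparr>red = {}, blue = inputs C, was_red = {}\<rparr>"

text \<open>\<open>Load\<close>, \<open>Store\<close>, \<open>Fire\<close>, \<open>Remove\<close> are the moves R1, R2, R3-NR, R4.\<close>

datatype 'v move = Load 'v | Store 'v | Fire 'v | Remove 'v

fun is_io :: "'v move \<Rightarrow> bool" where
  "is_io (Load v) = True"
| "is_io (Store v) = True"
| "is_io (Fire v) = False"
| "is_io (Remove v) = False"

definition place_red :: "'v \<Rightarrow> 'v pebbling \<Rightarrow> 'v pebbling" where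
  "place_red v s = s\<lparr>red := insert v (red s), was_red := insert v (was_red s)\<rparr>"

fun enabled :: "'v cdag \<Rightarrow> 'v pebbling \<Rightarrow> 'v move \<Rightarrow> bool" where
  "enabled C s (Load v) \<longleftrightarrow> v \<in> blue s"
| "enabled C s (Store v) \<longleftrightarrow> v \<in> red s"
| "enabled C s (Fire v) \<longleftrightarrow>
     v \<in> verts C - inputs C \<and> (\<forall>u. (u, v) \<in> edges C \<longrightarrow> u \<in> red s) \<and> v \<notin> was_red s"
| "enabled C s (Remove v) \<longleftrightarrow> v \<in> red s"

fun perform :: "'v move \<Rightarrow> 'v pebbling \<Rightarrow> 'v pebbling" where
  "perform (Load v) s = place_red v s"
| "perform (Store v) s = s\<lparr>blue := insert v (blue s)\<rparr>"
| "perform (Fire v) s = place_red v s"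
| "perform (Remove v) s = s\<lparr>red := red s - {v}\<rparr>"

inductive play :: "'v cdag \<Rightarrow> nat \<Rightarrow> 'v pebbling \<Rightarrow> 'v move list \<Rightarrow> 'v pebbling \<Rightarrow> bool"
  for C :: "'v cdag" and S :: nat where
  Nil: "play C S s [] s"
| Cons: "\<lbrakk>enabled C s m; card (red (perform m s)) \<le> S; play C S (perform m s) ms s'\<rbrakk>
    \<Longrightarrow> play C S s (m # ms) s'"

definition complete_calculation :: "'v cdag \<Rightarrow> nat \<Rightarrow> 'v move list \<Rightarrow> bool" where
  "complete_calculation C S ms \<longleftrightarrow>
     (\<exists>s. play C S (start C) ms s \<and> outputs C \<subseteq> blue s) \<and>
     (\<forall>v\<in>verts C - inputs C. count_list ms (Fire v) = 1)"

definition io_count :: "'v move list \<Rightarrow> nat" where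
  "io_count ms = length (filter is_io ms)"

definition In_set :: "'v cdag \<Rightarrow> 'v set \<Rightarrow> 'v set" where
  "In_set C W = {u \<in> verts C - W. \<exists>w\<in>W. (u, w) \<in> edges C}"

definition Out_set :: "'v cdag \<Rightarrow> 'v set \<Rightarrow> 'v set" where
  "Out_set C W = {v \<in> W. v \<in> outputs C \<or> (\<exists>w. w \<notin> W \<and> (v, w) \<in> edges C)}"

text \<open>
  The collection of \<open>h\<close> subsets is an indexed family \<open>P 1, \<dots>, P h\<close>, so its members may be
  empty, and the dependence graph lives on the indices. Values of \<open>P\<close> outside \<open>{1..h}\<close> are
  irrelevant.
\<close>

definition dependence :: "'v cdag \<Rightarrow> nat \<Rightarrow> (nat \<Rightarrow> 'v set) \<Rightarrow> (nat \<times> nat) set" where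
  "dependence C h P =
     {(i, j). i \<in> {1..h} \<and> j \<in> {1..h} \<and> i \<noteq> j \<and> (\<exists>u\<in>P i. \<exists>v\<in>P j. (u, v) \<in> edges C)}"

definition NR_partitioning :: "'v cdag \<Rightarrow> nat \<Rightarrow> nat \<Rightarrow> (nat \<Rightarrow> 'v set) \<Rightarrow> bool" where
  "NR_partitioning C T h P \<longleftrightarrow>
     (\<forall>i\<in>{1..h}. \<forall>j\<in>{1..h}. i \<noteq> j \<longrightarrow> P i \<inter> P j = {}) \<and>
     (\<Union>i\<in>{1..h}. P i) = verts C - inputs C \<and>
     acyclic (dependence C h P) \<and>
     (\<forall>i\<in>{1..h}. card (In_set C (P i)) \<le> T) \<and>
     (\<forall>i\<in>{1..h}. card (Out_set C (P i)) \<le> T)"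

end

theory Submission
  imports Defs
begin

text \<open>
  Cut the calculation into consecutive blocks containing \<open>S\<close> I/O moves each, except for the
  last one, and let \<open>V\<^sub>i\<close> be the set of vertices fired in the \<open>i\<close>-th block. A vertex of
  \<open>In(V\<^sub>i)\<close> is red at some point of the block without being fired in it, so it is red when the
  block starts or is loaded during the block. A vertex of \<open>Out(V\<^sub>i)\<close> is still needed after the
  block and cannot be fired again, so it is red when the block ends or is stored during the block.
  At most \<open>S\<close> vertices are red at any time and the block has at most \<open>S\<close> I/O moves, which gives
  the bound \<open>2S\<close> in both cases. A vertex is red only after it has been fired or loaded, hence arcs
  between different blocks point forward in time.
\<close>

section \<open>Cutting a move list into blocks by its number of I/O moves\<close>

lemma io_count_append [simp]: "io_count (xs @ ys) = io_count xs + io_count ys"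
  by (simp add: io_count_def)

text \<open>A single move raises the I/O count by at most one, so growing prefixes skip no value: a
  discrete intermediate value argument.\<close>

lemma io_count_prefix:
  assumes "n \<le> io_count ms"
  shows "\<exists>xs ys. ms = xs @ ys \<and> io_count xs = n"
  using assms
proof (induction ms rule: rev_induct)
  case Nil
  then show ?case by (simp add: io_count_def)
next
  case (snoc m ms)
  show ?case
  proof (cases "n \<le> io_count ms")
    case True
    then show ?thesis using snoc.IH by (metis append.assoc)
  next
    case False
    then have "io_count (ms @ [m]) = n"
      using snoc.prems by (auto simp: io_count_def split: if_splits)
    then show ?thesis by (metis append_Nil2)
  qed
qed

text \<open>Blocks with exactly \<open>S\<close> I/O moves are split off the front while possible;
  the rest, with fewer than \<open>S\<close>, is the last block. It is kept even if it has no I/O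
  move, since vertices may still be fired in it.\<close>

lemma io_blocks:
  assumes "S \<ge> 1"
  shows "\<exists>bs. concat bs = ms \<and> length bs = io_count ms div S + 1 \<and>
    (\<forall>b\<in>set bs. io_count b \<le> S)"
proof (induction "io_count ms" arbitrary: ms rule: less_induct)
  case less
  show ?case
  proof (cases "io_count ms < S")
    case True
    then show ?thesis by (intro exI[of _ "[ms]"]) simp
  next
    case False
    then obtain xs ys where ms: "ms = xs @ ys" "io_count xs = S"
      using io_count_prefix[of S ms] by auto
    then obtain bs where "concat bs = ys" "length bs = io_count ys div S + 1"
      "\<forall>b\<in>set bs. io_count b \<le> S"
      using less[of ys] assms by auto
    then show ?thesis
      using ms assms by (intro exI[of _ "xs # bs"]) (simp add: div_add_self1)
  qed
qed

text \<open>Meant for \<open>f = Load\<close> and \<open>f = Store\<close>: distinct vertices need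
  distinct I/O moves.\<close>

lemma card_moves_le_io_count:
  assumes "inj f" "\<And>v. is_io (f v)"
  shows "finite {v. f v \<in> set ms}" "card {v. f v \<in> set ms} \<le> io_count ms"
proof -
  have inj: "inj_on f {v. f v \<in> set ms}"
    using assms(1) by (rule inj_on_subset) simp
  have sub: "f ` {v. f v \<in> set ms} \<subseteq> set (filter is_io ms)"
    using assms(2) by auto
  show "finite {v. f v \<in> set ms}"
    using inj sub by (meson List.finite_set finite_imageD finite_subset)
  have "card {v. f v \<in> set ms} = card (f ` {v. f v \<in> set ms})"
    using inj by (simp add: card_image)
  also have "\<dots> \<le> card (set (filter is_io ms))"
    using sub by (intro card_mono) auto
  also have "\<dots> \<le> io_count ms"
    unfolding io_count_def by (rule card_length)
  finally show "card {v. f v \<in> set ms} \<le> io_count ms" .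
qed

lemma concat_split_nth:
  assumes "i < length bs"
  shows "concat bs = concat (take i bs) @ bs ! i @ concat (drop (Suc i) bs)"
  by (metis assms concat.simps(2) concat_append id_take_nth_drop)

lemma set_nth_subset_concat_take:
  assumes "j < i" "i < length bs"
  shows "set (bs ! j) \<subseteq> set (concat (take i bs))"
proof -
  have "bs ! j \<in> set (take i bs)"
    using assms by (metis in_set_conv_nth length_take nth_take
        order.strict_trans min_less_iff_conj)
  then show ?thesis by auto
qed

section \<open>Where pebbles come from in the course of a play\<close>

lemma play_appendD:
  assumes "play C S s (xs @ ys) s'"
  obtains t where "play C S s xs t" "play C S t ys s'"
  using assms
proof (induction xs arbitrary: s thesis)
  case Nil
  then show ?case by (auto intro: play.Nil)
next
  case (Cons m xs)
  from Cons.prems(2) have m: "enabled C s m" "card (red (perform m s)) \<le> S"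
    and rest: "play C S (perform m s) (xs @ ys) s'"
    by (auto elim: play.cases)
  obtain t where "play C S (perform m s) xs t" "play C S t ys s'"
    using Cons.IH[OF _ rest] by blast
  then show ?case using Cons.prems(1) play.Cons[OF m] by blast
qed

text \<open>Finiteness is carried along because \<open>card\<close> is 0 on infinite sets, so the
  bound alone would not limit the number of red pebbles.\<close>

lemma play_red_bound:
  assumes "play C S s ms s'" "finite (red s)" "card (red s) \<le> S"
  shows "finite (red s') \<and> card (red s') \<le> S"
  using assms
proof (induction rule: play.induct)
  case (Cons s m ms s')
  have "finite (red (perform m s))"
    using Cons.prems by (cases m) (auto simp: place_red_def)
  then show ?case
    using Cons by auto
qed auto

lemma play_Fire_in_verts:
  assumes "play C S s ms s'" "Fire v \<in> set ms"
  shows "v \<in> verts C - inputs C"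
  using assms by (induction rule: play.induct) auto

lemma play_pred_source:
  assumes "play C S s ms s'" "Fire w \<in> set ms" "(u, w) \<in> edges C"
  shows "u \<in> red s \<or> Fire u \<in> set ms \<or> Load u \<in> set ms"
  using assms
proof (induction rule: play.induct)
  case (Cons s m ms s')
  then show ?case by (cases m) (auto simp: place_red_def)
qed auto

lemma play_blue_source:
  assumes "play C S s ms s'" "v \<in> blue s'"
  shows "v \<in> blue s \<or> Store v \<in> set ms"
  using assms
proof (induction rule: play.induct)
  case (Cons s m ms s')
  then show ?case by (cases m) (auto simp: place_red_def)
qed auto

text \<open>Loading needs a blue pebble and storing a red one, so a vertex without any pebble can
  get one only by being fired. Until then it blocks all its successors. This serves both for the
  time before a vertex is fired and for the time after it has lost its last pebble.\<close>

lemma play_unavailable: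
  assumes "play C S s ms s'" "v \<notin> red s" "v \<notin> blue s" "Fire v \<notin> set ms"
  shows "v \<notin> red s'" "v \<notin> blue s'" "\<And>w. (v, w) \<in> edges C \<Longrightarrow> Fire w \<notin> set ms"
proof -
  have "v \<notin> red s' \<and> v \<notin> blue s' \<and> (\<forall>w. (v, w) \<in> edges C \<longrightarrow> Fire w \<notin> set ms)"
    using assms
  proof (induction rule: play.induct)
    case (Cons s m ms s')
    then show ?case by (cases m) (auto simp: place_red_def)
  qed auto
  then show "v \<notin> red s'" "v \<notin> blue s'" "\<And>w. (v, w) \<in> edges C \<Longrightarrow> Fire w \<notin> set ms"
    by auto
qed

section \<open>Which vertices a complete calculation fires, and how often\<close>

definition fired :: "'v move list \<Rightarrow> 'v set" where
  "fired ms = {v. Fire v \<in> set ms}"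

lemma complete_calculation_Fire:
  assumes "complete_calculation C S ms" "v \<in> verts C - inputs C"
  shows "Fire v \<in> set ms"
proof (rule ccontr)
  assume "Fire v \<notin> set ms"
  then have "count_list ms (Fire v) = 0" by simp
  then show False using assms by (auto simp: complete_calculation_def)
qed

lemma complete_calculation_fired:
  assumes "complete_calculation C S ms"
  shows "fired ms = verts C - inputs C"
proof
  obtain s where "play C S (start C) ms s"
    using assms by (auto simp: complete_calculation_def)
  then show "fired ms \<subseteq> verts C - inputs C"
    unfolding fired_def using play_Fire_in_verts by fast
  show "verts C - inputs C \<subseteq> fired ms"
    using complete_calculation_Fire[OF assms] by (auto simp: fired_def)
qed

lemma complete_calculation_Fire_unique:
  assumes "complete_calculation C S (xs @ ys)" "Fire v \<in> set xs"
  shows "Fire v \<notin> set ys"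
proof
  assume "Fire v \<in> set ys"
  then have "count_list xs (Fire v) \<noteq> 0" "count_list ys (Fire v) \<noteq> 0"
    using assms(2) by (simp_all add: count_list_0_iff)
  moreover have "v \<in> verts C - inputs C"
    using complete_calculation_fired[OF assms(1)] assms(2) by (auto simp: fired_def)
  then have "count_list (xs @ ys) (Fire v) = 1"
    using assms(1) by (auto simp: complete_calculation_def)
  ultimately show False by simp
qed

section \<open>Bounds on \<open>In_set\<close> and \<open>Out_set\<close> of one block\<close>

lemma card_Un_le_double:
  assumes "finite A" "card A \<le> S" "finite B" "card B \<le> (S::nat)" "X \<subseteq> A \<union> B"
  shows "card X \<le> 2 * S"
proof -
  have "card X \<le> card (A \<union> B)"
    using assms by (intro card_mono) auto
  also have "\<dots> \<le> card A + card B" by (rule card_Un_le)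
  finally show ?thesis using assms by simp
qed

lemma card_In_set_fired:
  assumes "play C S s ms s'" "finite (red s)" "card (red s) \<le> S" "io_count ms \<le> S"
  shows "card (In_set C (fired ms)) \<le> 2 * S"
proof (rule card_Un_le_double)
  show "In_set C (fired ms) \<subseteq> red s \<union> {v. Load v \<in> set ms}"
    using play_pred_source[OF assms(1)] by (auto simp: In_set_def fired_def)
  show "finite {v. Load v \<in> set ms}" "card {v. Load v \<in> set ms} \<le> S"
    using card_moves_le_io_count[of Load ms] assms(4) by (auto simp: inj_def)
qed (use assms in auto)

lemma card_Out_set_fired:
  assumes C: "is_cdag C"
    and complete: "complete_calculation C S (xs @ ys @ zs)"
    and io: "io_count ys \<le> S"
  shows "card (Out_set C (fired ys)) \<le> 2 * S"
proof -
  obtain s3 where s3: "play C S (start C) (xs @ ys @ zs) s3" "outputs C \<subseteq> blue s3"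
    using complete by (auto simp: complete_calculation_def)
  then obtain s1 s2 where s1: "play C S (start C) xs s1" and s2: "play C S s1 ys s2"
    and play3: "play C S s2 zs s3"
    by (meson play_appendD)
  have "finite (red s1)" "card (red s1) \<le> S"
    using play_red_bound[OF s1] by (auto simp: start_def)
  then have red: "finite (red s2)" "card (red s2) \<le> S"
    using play_red_bound[OF s2] by auto
  have "v \<in> red s2 \<union> {v. Store v \<in> set ys}" if v: "v \<in> Out_set C (fired ys)" for v
  proof (rule ccontr)
    assume "v \<notin> red s2 \<union> {v. Store v \<in> set ys}"
    then have nred: "v \<notin> red s2" and nstore: "Store v \<notin> set ys" by auto
    from v have Fire_v: "Fire v \<in> set ys" by (simp add: Out_set_def fired_def)
    then have unique: "Fire v \<notin> set xs" "Fire v \<notin> set zs"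
      using complete_calculation_Fire_unique[of C S xs "ys @ zs" v]
        complete_calculation_Fire_unique[of C S "xs @ ys" zs v] complete by auto
    have "v \<notin> inputs C"
      using play_Fire_in_verts[OF s2 Fire_v] by simp
    then have "v \<notin> red (start C)" "v \<notin> blue (start C)"
      by (auto simp: start_def)
    \<comment> \<open>\<open>v\<close> starts without pebbles and is not fired in \<open>xs\<close>,
      so it has none when the block starts and no successor of it is fired in
      \<open>xs\<close>.\<close>
    note before = play_unavailable[OF s1 this unique(1)]
    \<comment> \<open>By the end of the block \<open>v\<close> has lost every red pebble without
      being stored, so it has no pebble at all and, already fired, never regains one.\<close>
    have "v \<notin> blue s2"
      using play_blue_source[OF s2] before(2) nstore by auto
    note after = play_unavailable[OF play3 nred this unique(2)]
    have "v \<notin> outputs C"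
      using after(2) s3(2) by auto
    with v obtain w where w: "Fire w \<notin> set ys" "(v, w) \<in> edges C"
      by (auto simp: Out_set_def fired_def)
    \<comment> \<open>The incoming edge shows that \<open>w\<close> is not an input, so
      \<open>w\<close> must be fired, and only \<open>xs\<close> or \<open>zs\<close> are left for
      it.\<close>
    with C have "w \<in> verts C - inputs C"
      by (auto simp: is_cdag_def)
    then have "Fire w \<in> set (xs @ ys @ zs)"
      using complete_calculation_Fire[OF complete] by blast
    then show False
      using w before(3) after(3) by auto
  qed
  moreover have "finite {v. Store v \<in> set ys}" "card {v. Store v \<in> set ys} \<le> S"
    using card_moves_le_io_count[of Store ys] io by (auto simp: inj_def)
  ultimately show ?thesis
    using card_Un_le_double[OF red] by blast
qed

section \<open>Order of firing along edges, and assembly of the blocks\<close>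

lemma Fire_not_before_pred:
  assumes "complete_calculation C S (xs @ ys)"
    and "Fire u \<in> set ys" "Fire v \<in> set xs"
  shows "(u, v) \<notin> edges C"
proof -
  obtain s where "play C S (start C) xs s"
    using assms(1) by (meson complete_calculation_def play_appendD)
  \<comment> \<open>Being neither an input nor fired in \<open>xs\<close>, \<open>u\<close> has no
    pebble throughout \<open>xs\<close>, so no successor of it can be fired there.\<close>
  moreover have "u \<notin> inputs C"
    using complete_calculation_fired[OF assms(1)] assms(2) by (auto simp: fired_def)
  then have "u \<notin> red (start C)" "u \<notin> blue (start C)"
    by (auto simp: start_def)
  moreover have "Fire u \<notin> set xs"
    using complete_calculation_Fire_unique[OF assms(1)] assms(2) by blast
  ultimately show ?thesis
    using play_unavailable(3) assms(3) by metis
qed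

lemma NR_partitioning_blocks:
  assumes C: "is_cdag C"
    and complete: "complete_calculation C S (concat bs)"
    and io: "\<forall>b\<in>set bs. io_count b \<le> S"
  shows "NR_partitioning C (2 * S) (length bs) (\<lambda>i. fired (bs ! (i - 1)))"
    (is "NR_partitioning _ _ ?h ?P")
proof -
  have split: "complete_calculation C S (concat (take i bs) @ bs ! i @ concat (drop (Suc i) bs))"
    if "i < length bs" for i
    using complete concat_split_nth[OF that] by simp
  have earlier: "Fire v \<in> set (concat (take i bs))"
    if "v \<in> fired (bs ! j)" "j < i" "i < length bs" for v i j
    using that set_nth_subset_concat_take[OF that(2,3)] by (auto simp: fired_def)
  have disj: "fired (bs ! j) \<inter> fired (bs ! i) = {}" if "j < i" "i < length bs" for i j
    using complete_calculation_Fire_unique[OF split[OF that(2)] earlier[OF _ that]]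
    by (auto simp: fired_def)
  have forward: "(u, v) \<notin> edges C"
    if "u \<in> fired (bs ! i)" "v \<in> fired (bs ! j)" "j < i" "i < length bs" for u v i j
    using Fire_not_before_pred[OF split[OF that(4)] _ earlier[OF that(2-4)]] that(1)
    by (auto simp: fired_def)
  have "?P i \<inter> ?P j = {}" if "i \<in> {1..?h}" "j \<in> {1..?h}" "i \<noteq> j" for i j
  proof (cases "i < j")
    case True
    then have "i - 1 < j - 1" "j - 1 < ?h" using that by auto
    from disj[OF this] show ?thesis by auto
  next
    case False
    then have "j - 1 < i - 1" "i - 1 < ?h" using that by auto
    from disj[OF this] show ?thesis by auto
  qed
  moreover have "(\<Union>i\<in>{1..?h}. ?P i) = verts C - inputs C"
  proof -
    have "{1..?h} = Suc ` {..<?h}"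
      by (simp add: image_Suc_lessThan)
    then have "(\<Union>i\<in>{1..?h}. ?P i) = (\<Union>i<?h. fired (bs ! i))"
      by simp
    also have "\<dots> = (\<Union>b\<in>set bs. fired b)"
      by (simp add: set_conv_nth setcompr_eq_image lessThan_def image_image)
    also have "\<dots> = fired (concat bs)"
      by (auto simp: fired_def)
    finally show ?thesis
      using complete_calculation_fired[OF complete] by simp
  qed
  moreover have "acyclic (dependence C ?h ?P)"
  proof (rule acyclic_subset)
    \<comment> \<open>Every arc raises the block index, so the order of the naturals excludes
      cycles.\<close>
    show "acyclic less_than" by (simp add: wf_acyclic)
    show "dependence C ?h ?P \<subseteq> less_than"
    proof (clarsimp simp: dependence_def)
      fix i j u v
      assume "Suc 0 \<le> i" "i \<le> ?h" "Suc 0 \<le> j" "i \<noteq> j" "u \<in> fired (bs ! (i - Suc 0))"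
        "v \<in> fired (bs ! (j - Suc 0))" "(u, v) \<in> edges C"
      \<comment> \<open>Subsets are numbered from 1 and list entries from 0. As both indices are at
        least 1, the truncated subtraction preserves their order.\<close>
      moreover from this have "\<not> j - 1 < i - 1"
        using forward[of u "i - 1" v "j - 1"] by fastforce
      ultimately show "i < j" by arith
    qed
  qed
  moreover have "card (In_set C (fired b)) \<le> 2 * S" "card (Out_set C (fired b)) \<le> 2 * S"
    if "b \<in> set bs" for b
  proof -
    from that obtain i where i: "i < length bs" "b = bs ! i"
      by (auto simp: in_set_conv_nth)
    define xs zs where "xs = concat (take i bs)" and "zs = concat (drop (Suc i) bs)"
    have compl: "complete_calculation C S (xs @ b @ zs)"
      using split[OF i(1)] i(2) by (simp add: xs_def zs_def)
    then obtain s1 s2 where s1: "play C S (start C) xs s1" and s2: "play C S s1 b s2"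
      by (meson complete_calculation_def play_appendD)
    have "finite (red s1)" "card (red s1) \<le> S"
      using play_red_bound[OF s1] by (auto simp: start_def)
    then show "card (In_set C (fired b)) \<le> 2 * S"
      using card_In_set_fired[OF s2] io that by blast
    show "card (Out_set C (fired b)) \<le> 2 * S"
      using card_Out_set_fired[OF C compl] io that by blast
  qed
  ultimately show ?thesis
    unfolding NR_partitioning_def by auto
qed

theorem theorem3:
  fixes C :: "'v cdag" and S q :: nat and ms :: "'v move list"
  assumes "is_cdag C"
    and "S \<ge> 1"
    and "complete_calculation C S ms"
    and "io_count ms = q"
  shows "\<exists>(h::nat) P. NR_partitioning C (2 * S) h P \<and>
           int S * int h \<ge> int q \<and> int q \<ge> int S * (int h - 1)"
proof -
  obtain bs where bs: "concat bs = ms" "length bs = q div S + 1" "\<forall>b\<in>set bs. io_count b \<le> S"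
    using io_blocks[OF assms(2), of ms] unfolding assms(4) by blast
  then have "NR_partitioning C (2 * S) (length bs) (\<lambda>i. fired (bs ! (i - 1)))"
    using NR_partitioning_blocks[of C S bs] assms(1,3) by simp
  \<comment> \<open>With \<open>h = q div S + 1\<close>, both inequalities are division with
    remainder: \<open>q\<close> lies between \<open>S * (q div S)\<close> and the next multiple of
    \<open>S\<close>.\<close>
  moreover have "q \<le> S * (q div S + 1)"
    using assms(2) by (simp add: dividend_less_times_div less_imp_le)
  then have "int q \<le> int S * int (length bs)"
    using bs(2) by (metis of_nat_le_iff of_nat_mult)
  moreover have "S * (q div S) \<le> q" by simp
  then have "int S * (int (length bs) - 1) \<le> int q"
    using bs(2) by (metis add_diff_cancel_right' of_nat_1 of_nat_add of_nat_le_iff of_nat_mult)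
  ultimately show ?thesis by blast
qed

end
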